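(* Let $n,m\ge 0$ and let $q = Q_1x_1.\,Q_2x_2.\cdots Q_nx_n.\,\varphi(x_1,\dots,x_n)$ be a quantified boolean formula where each $Q_i\in\{\exists,\neg\exists\}$, the variables $x_1,\dots,x_n$ are distinct, and either $\varphi = C_1\land\dots\land C_m$ or $\varphi=\neg(C_1\land\dots\land C_m)$, each $C_j$ being a nonempty clause (disjunction of literals over $x_1,\dots,x_n$). Let $r$ be the JavaScript regex and $s$ the string associated with $q$ (constructed in the context, $r$ using negative lookaheads). Then $r$ matches $s$ starting from the beginning of $s$ if and only if $q$ is true.
   Context: **Regexes.** Fix an alphabet containing the characters $\mathtt{x}$, $\mathtt{;}$, $\mathtt{z}$. Regexes used here: the empty regex $\varepsilon$; a single character $c$; disjunction $r_1|r_2$; sequence $r_1r_2$; capture group $({}_g\, r)$ with group identifier $g$; backreference $\backslash g$; negative lookahead $(?!\,r)$. Brackets $\langle r\rangle$ are non-capturing and only used for parsing. $\backslash g\,\mathtt{x}$ is the sequence of $\backslash g$ and $\mathtt{x}$. **JavaScript backtracking semantics (for these constructs).** Fix a string $s=s_0\cdots s_{|s|-1}$. A group map $\gamma$ assigns to each group identifier either "undefined", "opened at $a$", or a closed range $(a,b)$; $\emptyset$ is the everywhere undefined map. An action is a regex or $\mathrm{Aclose}\,g$. For a list of actions $l$, a position $0\le p\le |s|$ and a group map $\gamma$, the ordered list of results $L(l,p,\gamma)$ is defined by: - $L([],p,\gamma)=[(p,\gamma)]$. - $L(\varepsilon::l,p,\gamma)=L(l,p,\gamma)$. - $L(c::l,p,\gamma)=L(l,p+1,\gamma)$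 if $p<|s|$ and $s_p=c$, else $[]$. - $L((r_1|r_2)::l,p,\gamma)=L(r_1::l,p,\gamma)$ concatenated with $L(r_2::l,p,\gamma)$ (in this order). - $L(r_1r_2::l,p,\gamma)=L(r_1::r_2::l,p,\gamma)$. - $L(({}_g\,r)::l,p,\gamma)=L(r::\mathrm{Aclose}\,g::l,p,\gamma[g\mapsto\text{opened at }p])$. - $L(\mathrm{Aclose}\,g::l,p,\gamma)=L(l,p,\gamma[g\mapsto(a,p)])$ where $g$ is opened at $a$ in $\gamma$. - $L(\backslash g::l,p,\gamma)$: if $\gamma(g)$ is not a closed range, it is $L(l,p,\gamma)$ (the backreference matches the empty string); if $\gamma(g)=(a,b)$ and $w=s_a\cdots s_{b-1}$, it is $L(l,p+|w|,\gamma)$ if $w$ occurs in $s$ at position $p$, else $[]$. - $L((?!\,r)::l,p,\gamma)=L(l,p,\gamma)$ if $L([r],p,\gamma)=[]$, else $[]$. The regex $r$ *matches $s$ from the beginning* if $L([r],0,\emptyset)\ne[]$ (the match need not reach the end of $s$). **Truth of $q$.** Usual truth of quantified boolean formulas, where $\neg\exists x_i.\psi$ means $\neg(\exists x_i.\psi)$. **Construction.** Group identifiers are $1,\dots,n$. Write $C_j=l_{j,1}\lor\dots\lor l_{j,v_j}$ with $v_j\ge1$. An empty concatenation of regexes is $\varepsilon$. - $R_{\mathrm{lit}}(x_i)=\backslash i$ and $R_{\mathrm{lit}}(\neg x_i)=\backslash i\,\mathtt{x}$. - $R_{\mathrm{cl}}(C_j)=\langle R_{\mathrm{lit}}(l_{j,1})|\cdots|R_{\mathrm{lit}}(l_{j,v_j})\rangle\,\mathtt{;}$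 - $R_{\mathrm{conj}}=R_{\mathrm{cl}}(C_1)\cdots R_{\mathrm{cl}}(C_m)$. - $R_{n+1}=R_{\mathrm{conj}}$ if $\varphi=C_1\land\dots\land C_m$, and $R_{n+1}=(?!\,R_{\mathrm{conj}})$ if $\varphi=\neg(C_1\land\dots\land C_m)$. - $E(x_i)=\langle({}_i\,\mathtt{x})|\mathtt{x}\rangle\,\mathtt{;}$ - For $1\le i\le n$: $R_i=E(x_i)R_{i+1}$ if $Q_i=\exists$, and $R_i=(?!\,E(x_i)R_{i+1})$ if $Q_i=\neg\exists$. - $r=R_1$, and $s$ is the string consisting of $n+m$ copies of $\mathtt{x;}$ followed by $\mathtt{z}$. *)

theory Defs
  imports Main
begin

section \<open>Regexes and their backtracking semantics\<close>

datatype 'c regex =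
    Eps
  | Chr 'c
  | Alt "'c regex" "'c regex"
  | Seq "'c regex" "'c regex"
  | Group nat "'c regex"
  | Backref nat
  | NegLook "'c regex"

datatype group_state = Undef | Opened nat | Closed nat nat

type_synonym group_map = "nat \<Rightarrow> group_state"

datatype 'c action = Areg "'c regex" | Aclose nat

text \<open>The range of a group is half open: \<open>Closed a b\<close> captures the characters
  at positions \<open>a, \<dots>, b - 1\<close>.\<close>

definition substring :: "'c list \<Rightarrow> nat \<Rightarrow> nat \<Rightarrow> 'c list" where
  "substring s a b = take (b - a) (drop a s)"

definition occurs_at :: "'c list \<Rightarrow> 'c list \<Rightarrow> nat \<Rightarrow> bool" where
  "occurs_at w s p \<longleftrightarrow> p + length w \<le> length s \<and> substring s p (p + length w) = w"

text \<open>Termination measure only; the default size does not decrease for sequences.\<close>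

primrec regex_weight :: "'c regex \<Rightarrow> nat" where
  "regex_weight Eps = 1"
| "regex_weight (Chr c) = 1"
| "regex_weight (Alt r1 r2) = regex_weight r1 + regex_weight r2 + 1"
| "regex_weight (Seq r1 r2) = regex_weight r1 + regex_weight r2 + 1"
| "regex_weight (Group g r) = regex_weight r + 2"
| "regex_weight (Backref g) = 1"
| "regex_weight (NegLook r) = regex_weight r + 1"

lemma regex_weight_pos: "0 < regex_weight r"
  by (induction r) auto

primrec action_weight :: "'c action \<Rightarrow> nat" where
  "action_weight (Areg r) = regex_weight r"
| "action_weight (Aclose g) = 1"

text \<open>\<open>results s l p \<gamma>\<close> is the list of results of the actions \<open>l\<close> on the string \<open>s\<close>, by
  decreasing priority. A close action is only meaningful for a group that is currently open;
  for other groups the value \<open>[]\<close> is a dummy. It is never reached from a single regex in which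
  no group is nested inside a group with the same identifier.\<close>

function results ::
  "'c list \<Rightarrow> 'c action list \<Rightarrow> nat \<Rightarrow> group_map \<Rightarrow> (nat \<times> group_map) list" where
  "results s [] p \<gamma> = [(p, \<gamma>)]"
| "results s (Areg Eps # l) p \<gamma> = results s l p \<gamma>"
| "results s (Areg (Chr c) # l) p \<gamma> =
     (if p < length s \<and> s ! p = c then results s l (p + 1) \<gamma> else [])"
| "results s (Areg (Alt r1 r2) # l) p \<gamma> =
     results s (Areg r1 # l) p \<gamma> @ results s (Areg r2 # l) p \<gamma>"
| "results s (Areg (Seq r1 r2) # l) p \<gamma> = results s (Areg r1 # Areg r2 # l) p \<gamma>"
| "results s (Areg (Group g r) # l) p \<gamma> =
     results s (Areg r # Aclose g # l) p (\<gamma>(g := Opened p))"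
| "results s (Aclose g # l) p \<gamma> =
     (case \<gamma> g of Opened a \<Rightarrow> results s l p (\<gamma>(g := Closed a p)) | _ \<Rightarrow> [])"
| "results s (Areg (Backref g) # l) p \<gamma> =
     (case \<gamma> g of
        Closed a b \<Rightarrow>
          (if occurs_at (substring s a b) s p
           then results s l (p + length (substring s a b)) \<gamma> else [])
      | _ \<Rightarrow> results s l p \<gamma>)"
| "results s (Areg (NegLook r) # l) p \<gamma> =
     (if results s [Areg r] p \<gamma> = [] then results s l p \<gamma> else [])"
  by pat_completeness auto
termination
  by (relation "measure (\<lambda>(s, l, p, \<gamma>). sum_list (map action_weight l))")
    (auto simp: regex_weight_pos)

definition matches_from_start :: "'c regex \<Rightarrow> 'c list \<Rightarrow> bool" where
  "matches_from_start r s \<longleftrightarrow> results s [Areg r] 0 (\<lambda>_. Undef) \<noteq> []"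


section \<open>Quantified boolean formulas\<close>

text \<open>The variable \<open>x\<^sub>i\<close> is represented by its index \<open>i\<close>, where \<open>1 \<le> i \<le> n\<close> and \<open>n\<close> is the
  length of the quantifier prefix; the number \<open>m\<close> of clauses is the length of the clause list.\<close>

datatype quant = Ex_q | NotEx_q

datatype literal = Pos (var: nat) | Neg (var: nat)

type_synonym clause = "literal list"

datatype matrix = Conj (clauses: "clause list") | NotConj (clauses: "clause list")

datatype qbf = QBF (prefix: "quant list") (matrix: matrix)

definition wf_qbf :: "qbf \<Rightarrow> bool" where
  "wf_qbf q \<longleftrightarrow>
     (\<forall>C \<in> set (clauses (matrix q)).
        C \<noteq> [] \<and> (\<forall>l \<in> set C. 1 \<le> var l \<and> var l \<le> length (prefix q)))"

type_synonym valuation = "nat \<Rightarrow> bool"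

primrec literal_true :: "valuation \<Rightarrow> literal \<Rightarrow> bool" where
  "literal_true v (Pos i) = v i"
| "literal_true v (Neg i) = (\<not> v i)"

definition conj_true :: "valuation \<Rightarrow> clause list \<Rightarrow> bool" where
  "conj_true v Cs \<longleftrightarrow> (\<forall>C \<in> set Cs. \<exists>l \<in> set C. literal_true v l)"

primrec matrix_true :: "valuation \<Rightarrow> matrix \<Rightarrow> bool" where
  "matrix_true v (Conj Cs) = conj_true v Cs"
| "matrix_true v (NotConj Cs) = (\<not> conj_true v Cs)"

text \<open>\<open>prefix_true i Qs \<phi> v\<close>: truth of \<open>Q\<^sub>i x\<^sub>i. \<cdots> Q\<^sub>n x\<^sub>n. \<phi>\<close> under \<open>v\<close>, with \<open>Qs = [Q\<^sub>i, \<dots>, Q\<^sub>n]\<close>.\<close>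

fun prefix_true :: "nat \<Rightarrow> quant list \<Rightarrow> matrix \<Rightarrow> valuation \<Rightarrow> bool" where
  "prefix_true i [] \<phi> v = matrix_true v \<phi>"
| "prefix_true i (Ex_q # Qs) \<phi> v = (\<exists>b. prefix_true (i + 1) Qs \<phi> (v(i := b)))"
| "prefix_true i (NotEx_q # Qs) \<phi> v = (\<not> (\<exists>b. prefix_true (i + 1) Qs \<phi> (v(i := b))))"

text \<open>A well-formed formula is closed, so the initial valuation is irrelevant.\<close>

definition qbf_true :: "qbf \<Rightarrow> bool" where
  "qbf_true q \<longleftrightarrow> prefix_true 1 (prefix q) (matrix q) (\<lambda>_. False)"


section \<open>The regex and the string associated with a formula\<close>

text \<open>The alphabet is an arbitrary type \<open>'c\<close>; the parameters \<open>cx\<close>, \<open>sc\<close> and \<open>cz\<close> are the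
  characters x, semicolon and z. Iterated disjunctions and sequences associate to the right;
  \<open>alts []\<close> is left unspecified.\<close>

fun alts :: "'c regex list \<Rightarrow> 'c regex" where
  "alts [r] = r"
| "alts (r # r' # rs) = Alt r (alts (r' # rs))"

fun seqs :: "'c regex list \<Rightarrow> 'c regex" where
  "seqs [] = Eps"
| "seqs [r] = r"
| "seqs (r # r' # rs) = Seq r (seqs (r' # rs))"

primrec R_lit :: "'c \<Rightarrow> literal \<Rightarrow> 'c regex" where
  "R_lit cx (Pos i) = Backref i"
| "R_lit cx (Neg i) = Seq (Backref i) (Chr cx)"

definition R_cl :: "'c \<Rightarrow> 'c \<Rightarrow> clause \<Rightarrow> 'c regex" where
  "R_cl cx sc C = Seq (alts (map (R_lit cx) C)) (Chr sc)"

definition R_conj :: "'c \<Rightarrow> 'c \<Rightarrow> clause list \<Rightarrow> 'c regex" where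
  "R_conj cx sc Cs = seqs (map (R_cl cx sc) Cs)"

primrec R_matrix :: "'c \<Rightarrow> 'c \<Rightarrow> matrix \<Rightarrow> 'c regex" where
  "R_matrix cx sc (Conj Cs) = R_conj cx sc Cs"
| "R_matrix cx sc (NotConj Cs) = NegLook (R_conj cx sc Cs)"

definition E_var :: "'c \<Rightarrow> 'c \<Rightarrow> nat \<Rightarrow> 'c regex" where
  "E_var cx sc i = Seq (Alt (Group i (Chr cx)) (Chr cx)) (Chr sc)"

text \<open>\<open>R_prefix cx sc i [Q\<^sub>i, \<dots>, Q\<^sub>n] \<phi>\<close> is \<open>R\<^sub>i\<close>.\<close>

fun R_prefix :: "'c \<Rightarrow> 'c \<Rightarrow> nat \<Rightarrow> quant list \<Rightarrow> matrix \<Rightarrow> 'c regex" where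
  "R_prefix cx sc i [] \<phi> = R_matrix cx sc \<phi>"
| "R_prefix cx sc i (Ex_q # Qs) \<phi> = Seq (E_var cx sc i) (R_prefix cx sc (i + 1) Qs \<phi>)"
| "R_prefix cx sc i (NotEx_q # Qs) \<phi> =
     NegLook (Seq (E_var cx sc i) (R_prefix cx sc (i + 1) Qs \<phi>))"

definition qbf_regex :: "'c \<Rightarrow> 'c \<Rightarrow> qbf \<Rightarrow> 'c regex" where
  "qbf_regex cx sc q = R_prefix cx sc 1 (prefix q) (matrix q)"

definition qbf_string :: "'c \<Rightarrow> 'c \<Rightarrow> 'c \<Rightarrow> qbf \<Rightarrow> 'c list" where
  "qbf_string cx sc cz q =
     concat (replicate (length (prefix q) + length (clauses (matrix q))) [cx, sc]) @ [cz]"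

end

theory Submission
  imports Defs
begin

text \<open>A valuation is encoded by the groups: true variables have captured the character x, false ones
  are undefined. Every quantifier and every clause consumes exactly one block ``x;''. The two
  branches of \<open>E(x\<^sub>i)\<close> produce the two values of \<open>x\<^sub>i\<close>. In a clause, a true literal consumes exactly
  the x of the block, whereas a false literal consumes nothing or fails on a second x, so
  that the semicolon is reached only after a true literal.\<close>

text \<open>The tail is only ever entered through its own results at some position and group map,
  and a lookahead runs its body without the tail. Tails can thus be replaced behind any first regex,
  as the unfolding of \<open>seqs\<close> requires.\<close>

lemma results_regex_cong:
  assumes "\<And>p \<gamma>. results s l p \<gamma> = results s l' p \<gamma>"
  shows "results s (Areg r # l) p \<gamma> = results s (Areg r # l') p \<gamma>"
  using assms
proof (induction r arbitrary: l l' p \<gamma>)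
  case (Seq r1 r2)
  have "results s (Areg r2 # l) p \<gamma> = results s (Areg r2 # l') p \<gamma>" for p \<gamma>
    using Seq.prems by (rule Seq.IH(2))
  from Seq.IH(1)[OF this] show ?case
    by (simp only: results.simps)
next
  case (Group g r)
  have "results s (Aclose g # l) p \<gamma> = results s (Aclose g # l') p \<gamma>" for p \<gamma>
    using Group.prems by (simp del: fun_upd_apply split: group_state.split)
  from Group.IH[OF this] show ?case
    by (simp only: results.simps)
next
  case (Alt r1 r2)
  have "results s (Areg r1 # l) p \<gamma> = results s (Areg r1 # l') p \<gamma>"
    and "results s (Areg r2 # l) p \<gamma> = results s (Areg r2 # l') p \<gamma>"
    using Alt.prems by (rule Alt.IH(1), rule Alt.IH(2))
  then show ?case
    by simp
qed (auto split: group_state.split)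

lemma results_seqs: "results s (Areg (seqs rs) # l) p \<gamma> = results s (map Areg rs @ l) p \<gamma>"
proof (induction rs arbitrary: p \<gamma> rule: seqs.induct)
  case (3 r r' rs)
  from results_regex_cong[OF this] show ?case
    by simp
qed simp_all

lemma results_alts:
  assumes "rs \<noteq> []"
  shows "results s (Areg (alts rs) # l) p \<gamma> = concat (map (\<lambda>r. results s (Areg r # l) p \<gamma>) rs)"
  using assms by (induction rs rule: alts.induct) auto

lemma nth_concat_replicate_pair:
  assumes "k < N"
  shows "(concat (replicate N [a, b]) @ zs) ! (2 * k) = a"
    and "(concat (replicate N [a, b]) @ zs) ! (2 * k + 1) = b"
  using assms
proof (induction N arbitrary: k)
  case (Suc N)
  { case 1 then show ?case using Suc.IH(1)[of "k - 1"] by (cases k) auto }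
  { case 2 then show ?case using Suc.IH(2)[of "k - 1"] by (cases k) auto }
qed auto

text \<open>Only the captured text is fixed, not its range, because each quantifier captures the x
  of a different block.\<close>

definition encodes :: "'c list \<Rightarrow> 'c \<Rightarrow> group_map \<Rightarrow> valuation \<Rightarrow> bool" where
  "encodes s c \<gamma> v \<longleftrightarrow>
     (\<forall>j. if v j then \<exists>a b. \<gamma> j = Closed a b \<and> substring s a b = [c] else \<gamma> j = Undef)"

text \<open>Abstracts the string to its blocks, so that positions are counted in blocks; the
  inequality in \<open>length_ge\<close> leaves room for the final z.\<close>

locale block_string =
  fixes s :: "'c list" and cx sc :: 'c and N :: nat
  assumes distinct_chars: "cx \<noteq> sc"
    and length_ge: "2 * N \<le> length s"
    and nth_x: "k < N \<Longrightarrow> s ! (2 * k) = cx"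
    and nth_semicolon: "k < N \<Longrightarrow> s ! Suc (2 * k) = sc"
begin

lemma block_in_range:
  assumes "k < N"
  shows "Suc (2 * k) < length s"
  using assms length_ge by linarith

lemma substring_x:
  assumes "k < N"
  shows "substring s (2 * k) (Suc (2 * k)) = [cx]"
  using assms block_in_range[OF assms]
  by (simp add: substring_def nth_x take_Suc_conv_app_nth)

lemma occurs_at_x:
  assumes "k < N"
  shows "occurs_at [cx] s (2 * k)"
  using block_in_range[OF assms] substring_x[OF assms] by (simp add: occurs_at_def)

text \<open>The semicolon belongs to the statement because a false positive literal succeeds on the
  empty string and is rejected only when the semicolon meets x.\<close>

lemma results_literal:
  assumes "k < N" "encodes s cx \<gamma> v"
  shows "results s (Areg (R_lit cx t) # Areg (Chr sc) # l) (2 * k) \<gamma> =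
           (if literal_true v t then results s l (2 * Suc k) \<gamma> else [])"
proof -
  have enc: "if v j then \<exists>a b. \<gamma> j = Closed a b \<and> substring s a b = [cx] else \<gamma> j = Undef" for j
    using assms(2) by (simp add: encodes_def)
  note block = block_in_range[OF assms(1)] nth_x[OF assms(1)] nth_semicolon[OF assms(1)]
    occurs_at_x[OF assms(1)] distinct_chars
  show ?thesis
  proof (cases t)
    case (Pos j)
    then show ?thesis using enc[of j] block by (cases "v j") auto
  next
    case (Neg j)
    then show ?thesis using enc[of j] block by (cases "v j") auto
  qed
qed

text \<open>Every true literal contributes its own copy of the results of \<open>l\<close>, so the
  claim is about nonemptiness instead of equality of lists.\<close>

lemma results_clause:
  assumes "k < N" "encodes s cx \<gamma> v" "C \<noteq> []"
  shows "results s (Areg (R_cl cx sc C) # l) (2 * k) \<gamma> \<noteq> [] \<longleftrightarrow>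
           (\<exists>t \<in> set C. literal_true v t) \<and> results s l (2 * Suc k) \<gamma> \<noteq> []"
  using assms(3) by (auto simp: R_cl_def results_alts results_literal[OF assms(1,2)] comp_def)

lemma results_conj:
  assumes "k + length Cs \<le> N" "encodes s cx \<gamma> v" "[] \<notin> set Cs"
  shows "results s [Areg (R_conj cx sc Cs)] (2 * k) \<gamma> \<noteq> [] \<longleftrightarrow> conj_true v Cs"
proof -
  have "results s (map (Areg \<circ> R_cl cx sc) Cs) (2 * k) \<gamma> \<noteq> [] \<longleftrightarrow> conj_true v Cs"
    using assms
  proof (induction Cs arbitrary: k)
    case (Cons C Cs)
    then have "results s (map (Areg \<circ> R_cl cx sc) Cs) (2 * Suc k) \<gamma> \<noteq> [] \<longleftrightarrow> conj_true v Cs"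
      by (intro Cons.IH) auto
    moreover have "k < N" "C \<noteq> []"
      using Cons.prems by auto
    ultimately show ?case
      using results_clause[OF _ assms(2), of k C] by (simp add: conj_true_def comp_def)
  qed (simp add: conj_true_def)
  then show ?thesis
    using results_seqs[of s "map (R_cl cx sc) Cs" "[]"] by (simp add: R_conj_def)
qed

lemma results_E_var:
  assumes "k < N"
  shows "results s (Areg (E_var cx sc i) # l) (2 * k) \<gamma> =
           results s l (2 * Suc k) (\<gamma>(i := Closed (2 * k) (Suc (2 * k)))) @ results s l (2 * Suc k) \<gamma>"
  using block_in_range[OF assms] nth_x[OF assms] nth_semicolon[OF assms] by (simp add: E_var_def)

text \<open>The bound by \<open>N\<close> reserves one block for each remaining quantifier and
  clause. The groups from \<open>i\<close> on are undefined because their variables have not been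
  assigned yet.\<close>

lemma results_prefix:
  assumes "k + length Qs + length (clauses \<phi>) \<le> N" "encodes s cx \<gamma> v"
    and "[] \<notin> set (clauses \<phi>)" "\<And>j. i \<le> j \<Longrightarrow> \<gamma> j = Undef"
  shows "results s [Areg (R_prefix cx sc i Qs \<phi>)] (2 * k) \<gamma> \<noteq> [] \<longleftrightarrow> prefix_true i Qs \<phi> v"
  using assms
proof (induction Qs arbitrary: k i \<gamma> v)
  case Nil
  then show ?case
    using results_conj[of k "clauses \<phi>"] by (cases \<phi>) auto
next
  case (Cons Q Qs)
  let ?\<gamma> = "\<gamma>(i := Closed (2 * k) (Suc (2 * k)))"
  let ?R = "R_prefix cx sc (i + 1) Qs \<phi>"
  have k: "k < N"
    using Cons.prems(1) by simp
  have "encodes s cx ?\<gamma> (v(i := True))"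
    using Cons.prems(2) substring_x[OF k] by (simp add: encodes_def)
  then have true: "results s [Areg ?R] (2 * Suc k) ?\<gamma> \<noteq> [] \<longleftrightarrow>
      prefix_true (i + 1) Qs \<phi> (v(i := True))"
    using Cons.prems by (intro Cons.IH) (simp_all del: fun_upd_apply, simp)
  \<comment> \<open>The branch without a group leaves \<open>\<gamma>\<close> as it is, and group
    \<open>i\<close> is still undefined, which encodes False.\<close>
  have "encodes s cx \<gamma> (v(i := False))"
    using Cons.prems(2,4) by (simp add: encodes_def)
  then have false: "results s [Areg ?R] (2 * Suc k) \<gamma> \<noteq> [] \<longleftrightarrow>
      prefix_true (i + 1) Qs \<phi> (v(i := False))"
    using Cons.prems by (intro Cons.IH) (simp_all del: fun_upd_apply)
  have "results s [Areg (Seq (E_var cx sc i) ?R)] (2 * k) \<gamma> \<noteq> [] \<longleftrightarrow>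
      (\<exists>b. prefix_true (i + 1) Qs \<phi> (v(i := b)))"
    using true false results_E_var[OF k] by (simp add: ex_bool_eq)
  \<comment> \<open>For \<open>NotEx_q\<close> the lookahead encloses all that remains of the
    formula. With no action behind it, it has a result exactly if its body has none.\<close>
  then show ?case
    by (cases Q) auto
qed

end

theorem theorem2:
  fixes cx sc cz :: 'c and q :: qbf
  assumes "distinct [cx, sc, cz]"
    and "wf_qbf q"
  shows "matches_from_start (qbf_regex cx sc q) (qbf_string cx sc cz q) \<longleftrightarrow> qbf_true q"
proof -
  let ?N = "length (prefix q) + length (clauses (matrix q))"
  have "block_string (qbf_string cx sc cz q) cx sc ?N"
    using assms(1) nth_concat_replicate_pair
    by unfold_locales (auto simp: qbf_string_def length_concat sum_list_replicate)
  then interpret block_string "qbf_string cx sc cz q" cx sc ?N .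
  show ?thesis
    \<comment> \<open>The empty group map encodes the all-false valuation from which
      \<open>qbf_true\<close> starts.\<close>
    using results_prefix[of 0 "prefix q" "matrix q" "\<lambda>_. Undef" "\<lambda>_. False" 1] assms(2)
    by (auto simp: matches_from_start_def qbf_regex_def qbf_true_def wf_qbf_def encodes_def)
qed

end
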